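(* Let $d\ge1$ and, for $(p,y,t)\in\mathbb{R}^d\times\mathbb{R}^d\times\mathbb{R}$, let $$\mathscr{L} f=\sqrt{|p|^2+1}\ \nabla_p\cdot(D\,\nabla_p f)-p\cdot\nabla_y f-\sqrt{|p|^2+1}\ \partial_t f,\qquad D=\frac{1}{\sqrt{|p|^2+1}}\big(\mathbb{I}_d+p\otimes p\big),$$ where $\mathbb{I}_d$ is the $d\times d$ identity matrix and $p\otimes p=(p_ip_j)_{i,j=1,\dots,d}$. Define the vector fields $$X_j=\sum_{k=1}^d\Big(\delta_{jk}+\frac{p_jp_k}{1+\sqrt{|p|^2+1}}\Big)\frac{\partial}{\partial p_k}\quad(j=1,\dots,d),\qquad Y=p\cdot\nabla_y+\sqrt{|p|^2+1}\,\frac{\partial}{\partial t}.$$ Then there exist smooth functions $c_1,\dots,c_d$ of $p\in\mathbb{R}^d$ such that, setting $X_{d+1}=\sum_{k=1}^d c_k(p)X_k-Y$, one has $$\mathscr{L}=\sum_{j=1}^dX_j^2+X_{d+1}.$$ Moreover, the Hörmander rank condition holds: $$\operatorname{rank}\operatorname{Lie}\{X_1,\dots,X_d,X_{d+1}\}(p,y,t)=2d+1\qquad\text{for every }(p,y,t)\in\mathbb{R}^{2d+1}.$$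
   Context: $\operatorname{Lie}\{X_1,\dots,X_{d+1}\}$ denotes the vector space generated by the vector fields $X_1,\dots,X_{d+1}$ and their (iterated) commutators; its rank at a point is the dimension of the space of vectors of $\mathbb{R}^{2d+1}$ obtained by evaluating its elements at that point. *)

theory Defs
  imports "HOL-Analysis.Analysis"
begin

text \<open>A point \<open>(p, y, t)\<close> of phase space; \<open>d = CARD('d)\<close>, which is automatically positive.\<close>

type_synonym 'd phase = "(real ^ 'd) \<times> (real ^ 'd) \<times> real"

text \<open>On a finite-dimensional domain, continuity of all iterated directional derivatives
  up to order \<open>k\<close> is the usual notion of class \<open>C\<^sup>k\<close>.\<close>

primrec is_Ck :: "nat \<Rightarrow> ('a::euclidean_space \<Rightarrow> 'b::real_normed_vector) \<Rightarrow> bool" where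
  "is_Ck 0 f \<longleftrightarrow> continuous_on UNIV f"
| "is_Ck (Suc k) f \<longleftrightarrow>
     (\<forall>x. f differentiable (at x)) \<and> (\<forall>v. is_Ck k (\<lambda>x. frechet_derivative f (at x) v))"

definition is_smooth :: "('a::euclidean_space \<Rightarrow> 'b::real_normed_vector) \<Rightarrow> bool" where
  "is_smooth f \<longleftrightarrow> (\<forall>k. is_Ck k f)"

text \<open>A vector field is given by its coefficient function \<open>V\<close>; as a first-order
  differential operator it sends \<open>f\<close> to \<open>\<Sum>i. V\<^sub>i \<partial>\<^sub>i f\<close>.\<close>

definition vf_apply ::
    "('a::real_normed_vector \<Rightarrow> 'a) \<Rightarrow> ('a \<Rightarrow> real) \<Rightarrow> 'a \<Rightarrow> real" where
  "vf_apply V f z = frechet_derivative f (at z) (V z)"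

text \<open>The coefficients of the commutator of operators \<open>V W - W V\<close>.\<close>

definition commutator ::
    "('a::real_normed_vector \<Rightarrow> 'a) \<Rightarrow> ('a \<Rightarrow> 'a) \<Rightarrow> 'a \<Rightarrow> 'a" where
  "commutator V W z =
     frechet_derivative W (at z) (V z) - frechet_derivative V (at z) (W z)"

inductive_set iterated_commutators ::
    "('a::real_normed_vector \<Rightarrow> 'a) set \<Rightarrow> ('a \<Rightarrow> 'a) set"
  for S :: "('a \<Rightarrow> 'a) set" where
  base: "V \<in> S \<Longrightarrow> V \<in> iterated_commutators S"
| step: "V \<in> iterated_commutators S \<Longrightarrow> W \<in> iterated_commutators S
           \<Longrightarrow> commutator V W \<in> iterated_commutators S"

text \<open>The linear span over \<open>\<real>\<close> (constant coefficients), written out because functions do not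
  form an instance of class \<open>real_vector\<close>.\<close>

definition Lie :: "('a::real_normed_vector \<Rightarrow> 'a) set \<Rightarrow> ('a \<Rightarrow> 'a) set" where
  "Lie S = {(\<lambda>z. \<Sum>V\<in>F. a V *\<^sub>R V z) | F a. finite F \<and> F \<subseteq> iterated_commutators S}"

definition rank_at :: "('a::real_normed_vector \<Rightarrow> 'a) set \<Rightarrow> 'a \<Rightarrow> nat" where
  "rank_at A z = dim ((\<lambda>V. V z) ` A)"

definition partial_p :: "'d::finite \<Rightarrow> ('d phase \<Rightarrow> real) \<Rightarrow> 'd phase \<Rightarrow> real" where
  "partial_p i f z = frechet_derivative f (at z) (axis i 1, 0, 0)"

definition partial_y :: "'d::finite \<Rightarrow> ('d phase \<Rightarrow> real) \<Rightarrow> 'd phase \<Rightarrow> real" where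
  "partial_y i f z = frechet_derivative f (at z) (0, axis i 1, 0)"

definition partial_t :: "('d::finite phase \<Rightarrow> real) \<Rightarrow> 'd phase \<Rightarrow> real" where
  "partial_t f z = frechet_derivative f (at z) (0, 0, 1)"

definition grad_p :: "('d::finite phase \<Rightarrow> real) \<Rightarrow> 'd phase \<Rightarrow> real ^ 'd" where
  "grad_p f z = (\<chi> i. partial_p i f z)"

definition grad_y :: "('d::finite phase \<Rightarrow> real) \<Rightarrow> 'd phase \<Rightarrow> real ^ 'd" where
  "grad_y f z = (\<chi> i. partial_y i f z)"

definition div_p :: "('d::finite phase \<Rightarrow> real ^ 'd) \<Rightarrow> 'd phase \<Rightarrow> real" where
  "div_p F z = (\<Sum>i\<in>UNIV. partial_p i (\<lambda>w. F w $ i) z)"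

definition p0 :: "real ^ 'd::finite \<Rightarrow> real" where
  "p0 p = sqrt ((norm p)\<^sup>2 + 1)"

definition diffusion_matrix :: "real ^ 'd::finite \<Rightarrow> real ^ 'd ^ 'd" where
  "diffusion_matrix p = (1 / p0 p) *\<^sub>R (mat 1 + (\<chi> i j. p $ i * p $ j))"

definition FP_op :: "('d::finite phase \<Rightarrow> real) \<Rightarrow> 'd phase \<Rightarrow> real" where
  "FP_op f z = (case z of (p, y, t) \<Rightarrow>
     p0 p * div_p (\<lambda>w. diffusion_matrix (fst w) *v grad_p f w) z
     - p \<bullet> grad_y f z - p0 p * partial_t f z)"

definition vfX :: "'d::finite \<Rightarrow> 'd phase \<Rightarrow> 'd phase" where
  "vfX j z = (case z of (p, y, t) \<Rightarrow>
     ((\<chi> k. (if j = k then 1 else 0) + p $ j * p $ k / (1 + p0 p)), 0, 0))"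

definition vfY :: "'d::finite phase \<Rightarrow> 'd phase" where
  "vfY z = (case z of (p, y, t) \<Rightarrow> (0, p, p0 p))"

definition vfX_last :: "('d::finite \<Rightarrow> real ^ 'd \<Rightarrow> real) \<Rightarrow> 'd phase \<Rightarrow> 'd phase" where
  "vfX_last c z = (\<Sum>k\<in>UNIV. c k (fst z) *\<^sub>R vfX k z) - vfY z"

end

(* The vectors A e_j, with A = I + p (x) p / (1 + p0), satisfy A^2 = I + p (x) p and A p = p0 p.
   The first identity matches the second-order parts, without any symmetry of the Hessian; the
   second turns the remaining first-order term, a multiple of p . grad_p, into a combination of
   the X_j. The rank is already attained by X_1, ..., X_(d+1) and the commutators [X_j, X_(d+1)]. *)
theory Submission
  imports Defs
begin

section \<open>Functions of class \<open>C\<^sup>k\<close>\<close>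

text \<open>The product, quotient and root rules leave undifferentiated factors in the derivative;
  the inductions need these factors at the lower order.\<close>

lemma is_Ck_Suc_imp:
  assumes "is_Ck (Suc k) f"
  shows "is_Ck k f"
  using assms
proof (induction k arbitrary: f)
  case 0
  then show ?case
    by (auto intro!: continuous_at_imp_continuous_on differentiable_imp_continuous_within)
next
  case (Suc k)
  from Suc.prems have "f differentiable (at x)" for x
    unfolding is_Ck.simps(2)[of "Suc k"] by blast
  moreover from Suc.prems have "is_Ck (Suc k) (\<lambda>x. frechet_derivative f (at x) v)" for v
    unfolding is_Ck.simps(2)[of "Suc k"] by blast
  ultimately show ?case
    using Suc.IH by (simp only: is_Ck.simps) blast
qed

text \<open>Uniqueness of the Frechet derivative lets any explicit formula \<open>f'\<close> stand
  for it, so each closure property reduces to a derivative rule plus induction.\<close>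

lemma is_Ck_SucI:
  assumes "\<And>x. (f has_derivative f' x) (at x)" and "\<And>v. is_Ck k (\<lambda>x. f' x v)"
  shows "is_Ck (Suc k) f"
proof -
  have "frechet_derivative f (at x) = f' x" for x
    using frechet_derivative_at[OF assms(1)] by simp
  with assms show ?thesis
    by (auto simp: differentiable_def)
qed

lemma is_Ck_SucD:
  assumes "is_Ck (Suc k) f"
  shows "(f has_derivative frechet_derivative f (at x)) (at x)"
    and "is_Ck k (\<lambda>x. frechet_derivative f (at x) v)"
  using assms by (simp_all add: frechet_derivative_works[symmetric])

lemma is_Ck_const: "is_Ck k (\<lambda>x. c)"
proof (induction k arbitrary: c)
  case (Suc k)
  then show ?case
    by (intro is_Ck_SucI[where f' = "\<lambda>_ _. 0"]) auto
qed auto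

lemma is_Ck_bounded_linear:
  assumes "bounded_linear f"
  shows "is_Ck k f"
proof (cases k)
  case 0
  then show ?thesis
    using assms by (auto intro: linear_continuous_on)
next
  case (Suc n)
  then show ?thesis
    using is_Ck_SucI[OF bounded_linear_imp_has_derivative[OF assms] is_Ck_const] by simp
qed

lemma is_Ck_add:
  assumes "is_Ck k f" "is_Ck k g"
  shows "is_Ck k (\<lambda>x. f x + g x)"
  using assms
proof (induction k arbitrary: f g)
  case 0
  then show ?case
    by (auto intro: continuous_intros)
next
  case (Suc k)
  show ?case
    by (rule is_Ck_SucI[OF has_derivative_add[OF is_Ck_SucD(1)[OF Suc.prems(1)]
              is_Ck_SucD(1)[OF Suc.prems(2)]]])
      (rule Suc.IH[OF is_Ck_SucD(2)[OF Suc.prems(1)] is_Ck_SucD(2)[OF Suc.prems(2)]])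
qed

lemma is_Ck_mult:
  fixes f g :: "'a::euclidean_space \<Rightarrow> 'b::real_normed_algebra"
  assumes "is_Ck k f" "is_Ck k g"
  shows "is_Ck k (\<lambda>x. f x * g x)"
  using assms
proof (induction k arbitrary: f g)
  case 0
  then show ?case
    by (auto intro: continuous_intros)
next
  case (Suc k)
  show ?case
    by (rule is_Ck_SucI[OF has_derivative_mult[OF is_Ck_SucD(1)[OF Suc.prems(1)]
              is_Ck_SucD(1)[OF Suc.prems(2)]]])
      (intro is_Ck_add Suc.IH is_Ck_SucD(2)[OF Suc.prems(1)] is_Ck_SucD(2)[OF Suc.prems(2)]
        is_Ck_Suc_imp[OF Suc.prems(1)] is_Ck_Suc_imp[OF Suc.prems(2)])
qed

lemma is_Ck_inverse:
  fixes f :: "'a::euclidean_space \<Rightarrow> 'b::real_normed_field"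
  assumes "is_Ck k f" and "\<And>x. f x \<noteq> 0"
  shows "is_Ck k (\<lambda>x. inverse (f x))"
  using assms
proof (induction k arbitrary: f)
  case 0
  then show ?case
    by (auto intro: continuous_intros)
next
  case (Suc k)
  note inv = Suc.IH[OF is_Ck_Suc_imp[OF Suc.prems(1)] Suc.prems(2)]
  \<comment> \<open>The derivative is written purely as a product of functions known to be of class
    C^k, with \<open>inv\<close> covering the inverse itself; hence the sign appears as a constant
    factor.\<close>
  have "((\<lambda>x. inverse (f x)) has_derivative
      (\<lambda>v. (- 1) * (inverse (f x) * (frechet_derivative f (at x) v * inverse (f x))))) (at x)" for x
    using Deriv.has_derivative_inverse[OF Suc.prems(2) is_Ck_SucD(1)[OF Suc.prems(1)]]
    by (simp add: mult.assoc)
  then show ?case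
    by (rule is_Ck_SucI) (intro is_Ck_mult is_Ck_const inv is_Ck_SucD(2)[OF Suc.prems(1)])
qed

lemma is_Ck_sqrt:
  assumes "is_Ck k f" and "\<And>x. f x > 0"
  shows "is_Ck k (\<lambda>x. sqrt (f x))"
  using assms
proof (induction k arbitrary: f)
  case 0
  then show ?case
    by (auto intro: continuous_intros)
next
  case (Suc k)
  note root = Suc.IH[OF is_Ck_Suc_imp[OF Suc.prems(1)] Suc.prems(2)]
  have nz: "sqrt (f x) \<noteq> 0" for x
    using Suc.prems(2)[of x] by simp
  have "((\<lambda>x. sqrt (f x)) has_derivative
      (\<lambda>v. frechet_derivative f (at x) v * (inverse (sqrt (f x)) * (1 / 2)))) (at x)" for x
    by (rule has_derivative_eq_rhs, rule has_derivative_real_sqrt[OF Suc.prems(2) is_Ck_SucD(1)[OF Suc.prems(1)]])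
      (simp add: fun_eq_iff field_simps)
  then show ?case
    by (rule is_Ck_SucI)
      (intro is_Ck_mult is_Ck_const is_Ck_inverse root nz is_Ck_SucD(2)[OF Suc.prems(1)])
qed

section \<open>The relativistic energy and the diffusion frame\<close>

lemma p0_ge_1: "p0 p \<ge> 1"
  by (simp add: p0_def)

lemma p0_neq_0 [simp]: "p0 p \<noteq> 0" "1 + p0 p \<noteq> 0"
  using p0_ge_1[of p] by linarith+

lemma inner_self_p0: "p \<bullet> p = (p0 p)\<^sup>2 - 1"
  by (simp add: p0_def power2_norm_eq_inner)

lemma p0_has_derivative: "(p0 has_derivative (\<lambda>v. p \<bullet> v / p0 p)) (at p)"
proof -
  have pos: "p \<bullet> p + 1 > 0"
    by (simp add: add_nonneg_pos)
  have "((\<lambda>q. sqrt (q \<bullet> q + 1)) has_derivative (\<lambda>v. p \<bullet> v / p0 p)) (at p)"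
    using pos by (auto intro!: derivative_eq_intros
        simp: p0_def power2_norm_eq_inner fun_eq_iff inner_commute field_simps)
  then show ?thesis
    by (simp add: p0_def[abs_def] power2_norm_eq_inner)
qed

lemma is_Ck_p0: "is_Ck k (p0 :: real ^ 'd::finite \<Rightarrow> real)"
proof -
  have sq: "is_Ck k (\<lambda>p :: real ^ 'd. p \<bullet> p + 1)"
  proof (cases k)
    case 0
    then show ?thesis by (auto intro!: continuous_intros)
  next
    case (Suc n)
    \<comment> \<open>For fixed \<open>v\<close> the derivative is linear in \<open>p\<close>, hence
      of class C^k for every order.\<close>
    have "is_Ck (Suc n) (\<lambda>p :: real ^ 'd. p \<bullet> p + 1)"
      by (rule is_Ck_SucI[where f' = "\<lambda>p v. 2 * (p \<bullet> v)"])
        (auto intro!: derivative_eq_intros is_Ck_bounded_linear bounded_linear_intros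
          simp: inner_commute)
    then show ?thesis by (simp add: Suc)
  qed
  have "is_Ck k (\<lambda>p :: real ^ 'd. sqrt (p \<bullet> p + 1))"
    by (rule is_Ck_sqrt[OF sq]) (simp add: add_nonneg_pos)
  then show ?thesis
    by (simp add: p0_def[abs_def] power2_norm_eq_inner)
qed

lemma nth_has_derivative: "((\<lambda>p. p $ i) has_derivative (\<lambda>v. v $ i)) F"
  by (rule bounded_linear_imp_has_derivative[OF bounded_linear_vec_nth])

text \<open>Column \<open>j\<close> of the positive square root A of I + p (x) p: A acts by p0 along
  p and by 1 on the orthogonal complement of p.\<close>

definition frame :: "'d::finite \<Rightarrow> real ^ 'd \<Rightarrow> real ^ 'd" where
  "frame j p = axis j 1 + (p $ j / (1 + p0 p)) *\<^sub>R p"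

lemma vfX_frame: "vfX j z = (frame j (fst z), 0, 0)"
  by (cases z) (simp add: vfX_def frame_def vec_eq_iff axis_def)

lemma frame_nth: "frame j p $ k = (if j = k then 1 else 0) + p $ j * p $ k / (1 + p0 p)"
  by (simp add: frame_def axis_def)

lemma frame_sym: "frame j p $ k = frame k p $ j"
  by (simp add: frame_nth mult.commute)

lemma sum_squares_p0: "(\<Sum>j\<in>UNIV. p $ j * p $ j) = (p0 p)\<^sup>2 - 1"
  using inner_self_p0[of p] by (simp add: inner_vec_def)

text \<open>Since |p|^2 = (p0 - 1)(p0 + 1), the denominator cancels and the eigenvalue of A on p is
  1 + (p0 - 1).\<close>

lemma inner_frame: "p \<bullet> frame j p = p0 p * p $ j"
proof -
  have "p \<bullet> frame j p = p $ j + p $ j / (1 + p0 p) * ((p0 p)\<^sup>2 - 1)"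
    by (simp add: frame_def inner_add_right inner_axis inner_self_p0)
  also have "\<dots> = p0 p * p $ j"
    by (simp add: divide_simps) (simp add: algebra_simps power2_eq_square)
  finally show ?thesis .
qed

lemma sum_frame_nth: "(\<Sum>j\<in>UNIV. p $ j * frame j p $ k) = p0 p * p $ k"
  using inner_frame[of p k] by (simp add: inner_vec_def frame_sym[of _ p k])

lemma trace_frame: "(\<Sum>j\<in>UNIV. frame j p $ j) = real CARD('d) + p0 p - 1"
  for p :: "real ^ 'd::finite"
proof -
  have "(\<Sum>j\<in>UNIV. frame j p $ j) = real CARD('d) + (\<Sum>j\<in>UNIV. p $ j * p $ j) / (1 + p0 p)"
    by (simp add: frame_nth sum.distrib sum_divide_distrib)
  also have "\<dots> = real CARD('d) + p0 p - 1"
    unfolding sum_squares_p0 by (simp add: divide_simps) (simp add: algebra_simps power2_eq_square)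
  finally show ?thesis .
qed

text \<open>Only one factor A is expanded; its rank-one part meets A p = p0 p, and 1/(1 + p0) +
  p0/(1 + p0) = 1 combines the two multiples of p_i p_k.\<close>

lemma frame_square:
  "(\<Sum>j\<in>UNIV. frame j p $ i * frame j p $ k) = (if i = k then 1 else 0) + p $ i * p $ k"
proof -
  have "(\<Sum>j\<in>UNIV. frame j p $ i * frame j p $ k)
      = (\<Sum>j\<in>UNIV. (if j = i then frame j p $ k else 0) + p $ i / (1 + p0 p) * (p $ j * frame j p $ k))"
    by (intro sum.cong) (auto simp: frame_nth[of _ p i] algebra_simps)
  also have "\<dots> = frame i p $ k + p $ i / (1 + p0 p) * (p0 p * p $ k)"
    unfolding sum.distrib sum_distrib_left[symmetric] sum_frame_nth by simp
  also have "\<dots> = (if i = k then 1 else 0) + p $ i * p $ k"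
    by (simp add: frame_nth divide_simps) (simp add: algebra_simps)
  finally show ?thesis .
qed

text \<open>The inverse of the frame matrix is \<open>I - p \<otimes> p / (p0 (1 + p0))\<close>.\<close>

lemma frame_spans:
  "v = (\<Sum>j\<in>UNIV. (v $ j - (p \<bullet> v) * p $ j / (p0 p * (1 + p0 p))) *\<^sub>R frame j p)"
proof -
  have "(\<Sum>j\<in>UNIV. (v $ j - (p \<bullet> v) * p $ j / (p0 p * (1 + p0 p))) * frame j p $ k) = v $ k" for k
  proof -
    have "(\<Sum>j\<in>UNIV. v $ j * frame j p $ k) = v $ k + (p \<bullet> v) * p $ k / (1 + p0 p)"
    proof -
      have "(\<Sum>j\<in>UNIV. v $ j * frame j p $ k)
          = (\<Sum>j\<in>UNIV. (if j = k then v $ j else 0) + p $ k / (1 + p0 p) * (p $ j * v $ j))"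
        by (intro sum.cong) (auto simp: frame_nth algebra_simps)
      also have "\<dots> = v $ k + p $ k / (1 + p0 p) * (p \<bullet> v)"
        unfolding sum.distrib sum_distrib_left[symmetric] by (simp add: inner_vec_def)
      finally show ?thesis by simp
    qed
    \<comment> \<open>By A p = p0 p this equals \<open>(p \<bullet> v) * p $ k / (1 + p0 p)\<close>,
      exactly the amount by which A v exceeds v.\<close>
    moreover have "(\<Sum>j\<in>UNIV. (p \<bullet> v) * p $ j / (p0 p * (1 + p0 p)) * frame j p $ k)
        = (p \<bullet> v) / (p0 p * (1 + p0 p)) * (\<Sum>j\<in>UNIV. p $ j * frame j p $ k)"
      by (simp add: sum_distrib_left mult.assoc)
    ultimately show ?thesis
      by (simp add: left_diff_distrib sum_subtractf sum_frame_nth)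
  qed
  then show ?thesis
    by (simp add: vec_eq_iff)
qed

section \<open>First derivatives of the frame matrix and of the diffusion matrix\<close>

definition dframe :: "'d::finite \<Rightarrow> 'd \<Rightarrow> real ^ 'd \<Rightarrow> real ^ 'd \<Rightarrow> real" where
  "dframe j k p v = (v $ j * p $ k + p $ j * v $ k) / (1 + p0 p)
     - (p \<bullet> v) * p $ j * p $ k / (p0 p * (1 + p0 p)\<^sup>2)"

lemma frame_nth_has_derivative:
  "((\<lambda>p. frame j p $ k) has_derivative dframe j k p) (at p)"
proof -
  have "((\<lambda>p. (if j = k then 1 else 0) + p $ j * p $ k / (1 + p0 p)) has_derivative dframe j k p) (at p)"
    by (auto intro!: derivative_eq_intros p0_has_derivative nth_has_derivative simp: fun_eq_iff dframe_def)
      (simp_all add: divide_simps, simp_all add: algebra_simps power2_eq_square)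
  then show ?thesis
    by (simp add: frame_nth)
qed

text \<open>This is the first-order coefficient produced by the sum of the X_j^2. Along A e_j the
  factor \<open>p \<bullet> v\<close> becomes p0 p_j, so only the trace of A, the vector A p and
  |p|^2 remain to be summed.\<close>

lemma sum_dframe_frame:
  "(\<Sum>j\<in>UNIV. dframe j k p (frame j p)) = p $ k * (real CARD('d) + p0 p) / (1 + p0 p)"
  for p :: "real ^ 'd::finite"
proof -
  have "(\<Sum>j\<in>UNIV. dframe j k p (frame j p))
      = (\<Sum>j\<in>UNIV. p $ k / (1 + p0 p) * frame j p $ j + 1 / (1 + p0 p) * (p $ j * frame j p $ k)
          - p $ k / (1 + p0 p)\<^sup>2 * (p $ j * p $ j))"
    by (intro sum.cong) (auto simp: dframe_def inner_frame diff_divide_distrib add_divide_distrib mult_ac)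
  also have "\<dots> = p $ k / (1 + p0 p) * (real CARD('d) + p0 p - 1) + 1 / (1 + p0 p) * (p0 p * p $ k)
          - p $ k / (1 + p0 p)\<^sup>2 * ((p0 p)\<^sup>2 - 1)"
    unfolding sum.distrib sum_subtractf sum_distrib_left[symmetric] sum_frame_nth trace_frame
        sum_squares_p0 ..
  also have "\<dots> = p $ k * (real CARD('d) + p0 p) / (1 + p0 p)"
    by (simp add: divide_simps) (simp add: algebra_simps power2_eq_square)
  finally show ?thesis .
qed

lemma diffusion_matrix_nth:
  "diffusion_matrix p $ i $ k = ((if i = k then 1 else 0) + p $ i * p $ k) / p0 p"
  by (simp add: diffusion_matrix_def mat_def)

definition ddiff :: "'d::finite \<Rightarrow> 'd \<Rightarrow> real ^ 'd \<Rightarrow> real ^ 'd \<Rightarrow> real" where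
  "ddiff i k p v = (v $ i * p $ k + p $ i * v $ k) / p0 p
     - (p \<bullet> v) * ((if i = k then 1 else 0) + p $ i * p $ k) / p0 p ^ 3"

lemma diffusion_matrix_has_derivative:
  "((\<lambda>p. diffusion_matrix p $ i $ k) has_derivative ddiff i k p) (at p)"
proof -
  have "((\<lambda>p. ((if i = k then 1 else 0) + p $ i * p $ k) / p0 p) has_derivative ddiff i k p) (at p)"
    by (auto intro!: derivative_eq_intros p0_has_derivative nth_has_derivative simp: fun_eq_iff ddiff_def)
      (simp_all add: divide_simps, simp_all add: algebra_simps power3_eq_cube)
  then show ?thesis
    by (simp add: diffusion_matrix_nth)
qed

text \<open>The divergence of D. The diagonal terms p_k/p0 - p_k/p0^3 cancel against |p|^2 p_k/p0^3,
  leaving d copies of p_k/p0.\<close>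

lemma sum_ddiff:
  "(\<Sum>i\<in>UNIV. ddiff i k p (axis i 1)) = real CARD('d) * p $ k / p0 p"
  for p :: "real ^ 'd::finite"
proof -
  have "(\<Sum>i\<in>UNIV. ddiff i k p (axis i 1))
      = (\<Sum>i\<in>UNIV. p $ k / p0 p + (if i = k then p $ i / p0 p - p $ i / p0 p ^ 3 else 0)
          - p $ k / p0 p ^ 3 * (p $ i * p $ i))"
    unfolding ddiff_def inner_axis
    by (intro sum.cong) (auto simp: axis_def add_divide_distrib diff_divide_distrib distrib_left algebra_simps)
  also have "\<dots> = real CARD('d) * (p $ k / p0 p) + (p $ k / p0 p - p $ k / p0 p ^ 3)
          - p $ k / p0 p ^ 3 * ((p0 p)\<^sup>2 - 1)"
    unfolding sum.distrib sum_subtractf sum_distrib_left[symmetric] sum_squares_p0 by simp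
  also have "\<dots> = real CARD('d) * p $ k / p0 p"
    by (simp add: divide_simps) (simp add: algebra_simps power2_eq_square power3_eq_cube)
  finally show ?thesis .
qed

section \<open>The sum-of-squares representation\<close>

text \<open>Since \<open>p\<close> is an eigenvector of the frame matrix with eigenvalue \<open>p0\<close>, the first-order
  defect \<open>(d - 1) p0 / (1 + p0) p \<bullet> \<nabla>\<^sub>p\<close> is the frame combination with these
  coefficients.\<close>

definition drift :: "'d::finite \<Rightarrow> real ^ 'd \<Rightarrow> real" where
  "drift k p = (real CARD('d) - 1) * (p $ k * inverse (1 + p0 p))"

lemma is_smooth_drift: "is_smooth (drift k)"
  unfolding is_smooth_def drift_def[abs_def]
  by (intro allI is_Ck_mult is_Ck_const is_Ck_inverse is_Ck_add is_Ck_p0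
      is_Ck_bounded_linear bounded_linear_vec_nth p0_neq_0)

lemma sum_drift_frame:
  "(\<Sum>k\<in>UNIV. drift k p *\<^sub>R frame k p) = ((real CARD('d) - 1) * p0 p / (1 + p0 p)) *\<^sub>R p"
  for p :: "real ^ 'd::finite"
proof -
  have "(\<Sum>k\<in>UNIV. drift k p * frame k p $ i) = (real CARD('d) - 1) * p0 p / (1 + p0 p) * p $ i" for i
  proof -
    have "(\<Sum>k\<in>UNIV. drift k p * frame k p $ i)
        = (\<Sum>k\<in>UNIV. (real CARD('d) - 1) / (1 + p0 p) * (p $ k * frame k p $ i))"
      by (intro sum.cong) (auto simp: drift_def divide_inverse)
    then show ?thesis
      unfolding sum_distrib_left[symmetric] sum_frame_nth by simp
  qed
  then show ?thesis
    by (simp add: vec_eq_iff)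
qed

lemma vfX_last_drift:
  "vfX_last drift z = (((real CARD('d) - 1) * p0 (fst z) / (1 + p0 (fst z))) *\<^sub>R fst z, - fst z, - p0 (fst z))"
  for z :: "'d::finite phase"
proof -
  have "(\<Sum>k\<in>UNIV. drift k (fst z) *\<^sub>R vfX k z) = (\<Sum>k\<in>UNIV. drift k (fst z) *\<^sub>R frame k (fst z), 0, 0)"
    by (simp add: prod_eq_iff fst_sum snd_sum vfX_frame)
  then show ?thesis
    unfolding vfX_last_def sum_drift_frame by (cases z) (simp add: vfY_def)
qed

text \<open>Turns derivatives along vector fields into partial derivatives; it is applied to the
  derivative of \<open>f\<close> and to those of its first partials.\<close>

lemma linear_phase_expand:
  fixes D :: "'d::finite phase \<Rightarrow> real"
  assumes "linear D"
  shows "D (v, w, s) = (\<Sum>k\<in>UNIV. v $ k * D (axis k 1, 0, 0)) + (\<Sum>k\<in>UNIV. w $ k * D (0, axis k 1, 0))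
    + s * D (0, 0, 1)"
proof -
  have "(v, w, s) = (\<Sum>k\<in>UNIV. v $ k *\<^sub>R (axis k 1, 0, 0)) + (\<Sum>k\<in>UNIV. w $ k *\<^sub>R (0, axis k 1, 0))
      + s *\<^sub>R (0, 0, 1)"
    by (simp add: prod_eq_iff fst_sum snd_sum vec_eq_iff axis_def if_distrib cong: if_cong)
  then have "D (v, w, s) = D ((\<Sum>k\<in>UNIV. v $ k *\<^sub>R (axis k 1, 0, 0)) + (\<Sum>k\<in>UNIV. w $ k *\<^sub>R (0, axis k 1, 0))
      + s *\<^sub>R (0, 0, 1))"
    by (rule arg_cong)
  then show ?thesis
    by (simp only: linear_add[OF assms] linear_sum[OF assms] linear_scale[OF assms] real_scaleR_def)
qed

lemma fst_comp_has_derivative: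
  assumes "(g has_derivative g') (at (fst z))"
  shows "((\<lambda>w. g (fst w)) has_derivative (\<lambda>v. g' (fst v))) (at z)"
  using has_derivative_compose[OF bounded_linear_imp_has_derivative[OF bounded_linear_fst] assms] .

section \<open>Both sides of the operator identity in partial derivatives, for \<open>f\<close> of
  class C^2\<close>

context
  fixes f :: "'d::finite phase \<Rightarrow> real"
  assumes C2: "is_Ck 2 f"
begin

lemma C2_linear: "linear (frechet_derivative f (at z))"
  using C2 unfolding numeral_2_eq_2 by (blast intro: has_derivative_linear is_Ck_SucD(1))

lemma C2_partial_has_derivative:
  "(partial_p k f has_derivative frechet_derivative (partial_p k f) (at z)) (at z)"
proof -
  have "is_Ck (Suc (Suc 0)) f"
    using C2 by (simp only: numeral_2_eq_2)
  then show ?thesis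
    using is_Ck_SucD(1)[OF is_Ck_SucD(2), of 0 f "(axis k 1, 0, 0)"] by (simp add: partial_p_def[abs_def])
qed

abbreviation (input) hess :: "'d phase \<Rightarrow> 'd \<Rightarrow> 'd \<Rightarrow> real" where
  "hess z i k \<equiv> partial_p i (partial_p k f) z"

text \<open>Product rule: the outer \<open>p0\<close> cancels the 1/p0 in D, and the divergence of D
  from \<open>sum_ddiff\<close> contributes d times p . grad_p.\<close>

lemma FP_op_expand:
  fixes z :: "'d phase"
  defines "p \<equiv> fst z"
  shows "FP_op f z =
      (\<Sum>i\<in>UNIV. \<Sum>k\<in>UNIV. ((if i = k then 1 else 0) + p $ i * p $ k) * hess z i k)
    + real CARD('d) * (\<Sum>k\<in>UNIV. p $ k * partial_p k f z)
    - p \<bullet> grad_y f z - p0 p * partial_t f z"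
proof -
  have "partial_p i (\<lambda>w. (diffusion_matrix (fst w) *v grad_p f w) $ i) z
      = (\<Sum>k\<in>UNIV. diffusion_matrix p $ i $ k * hess z i k + ddiff i k p (axis i 1) * partial_p k f z)" for i
  proof -
    have "((\<lambda>w. \<Sum>k\<in>UNIV. diffusion_matrix (fst w) $ i $ k * partial_p k f w) has_derivative
       (\<lambda>v. \<Sum>k\<in>UNIV. diffusion_matrix (fst z) $ i $ k * frechet_derivative (partial_p k f) (at z) v
          + ddiff i k (fst z) (fst v) * partial_p k f z)) (at z)"
      by (intro has_derivative_sum has_derivative_mult C2_partial_has_derivative
          fst_comp_has_derivative diffusion_matrix_has_derivative)
    from frechet_derivative_at[OF this, symmetric] show ?thesis
      by (simp add: matrix_vector_mult_def grad_p_def partial_p_def[of i] p_def)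
  qed
  then have "div_p (\<lambda>w. diffusion_matrix (fst w) *v grad_p f w) z
      = (\<Sum>i\<in>UNIV. \<Sum>k\<in>UNIV. diffusion_matrix p $ i $ k * hess z i k)
        + (\<Sum>k\<in>UNIV. (\<Sum>i\<in>UNIV. ddiff i k p (axis i 1)) * partial_p k f z)"
    by (simp add: div_p_def sum.distrib sum_distrib_right sum.swap[of "\<lambda>i k. ddiff i k p (axis i 1) * _ k"])
  then have "p0 p * div_p (\<lambda>w. diffusion_matrix (fst w) *v grad_p f w) z
      = (\<Sum>i\<in>UNIV. \<Sum>k\<in>UNIV. ((if i = k then 1 else 0) + p $ i * p $ k) * hess z i k)
        + real CARD('d) * (\<Sum>k\<in>UNIV. p $ k * partial_p k f z)"
    by (simp add: sum_ddiff diffusion_matrix_nth distrib_left sum_distrib_left mult.assoc)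
  then show ?thesis
    by (simp add: FP_op_def p_def split_beta)
qed

text \<open>Product rule: differentiating \<open>partial_p k f\<close> produces the entries of A^2,
  differentiating the coefficients produces \<open>sum_dframe_frame\<close>.\<close>

lemma vfX_square_expand:
  fixes z :: "'d phase"
  defines "p \<equiv> fst z"
  shows "(\<Sum>j\<in>UNIV. vf_apply (vfX j) (vf_apply (vfX j) f) z) =
      (\<Sum>i\<in>UNIV. \<Sum>k\<in>UNIV. ((if i = k then 1 else 0) + p $ i * p $ k) * hess z i k)
    + (real CARD('d) + p0 p) / (1 + p0 p) * (\<Sum>k\<in>UNIV. p $ k * partial_p k f z)"
proof -
  have X: "vf_apply (vfX j) f = (\<lambda>w. \<Sum>k\<in>UNIV. frame j (fst w) $ k * partial_p k f w)" for j
    unfolding vf_apply_def[abs_def] vfX_frame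
    by (subst linear_phase_expand[OF C2_linear])
      (simp add: partial_p_def linear_0[OF C2_linear])
  have "vf_apply (vfX j) (vf_apply (vfX j) f) z
      = (\<Sum>k\<in>UNIV. frame j p $ k * (\<Sum>i\<in>UNIV. frame j p $ i * hess z i k)
          + dframe j k p (frame j p) * partial_p k f z)" for j
  proof -
    have "((\<lambda>w. \<Sum>k\<in>UNIV. frame j (fst w) $ k * partial_p k f w) has_derivative
       (\<lambda>v. \<Sum>k\<in>UNIV. frame j (fst z) $ k * frechet_derivative (partial_p k f) (at z) v
          + dframe j k (fst z) (fst v) * partial_p k f z)) (at z)"
      by (intro has_derivative_sum has_derivative_mult C2_partial_has_derivative
          fst_comp_has_derivative frame_nth_has_derivative)
    moreover have "frechet_derivative (partial_p k f) (at z) (frame j p, 0, 0)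
        = (\<Sum>i\<in>UNIV. frame j p $ i * hess z i k)" for k
      by (subst linear_phase_expand[OF has_derivative_linear[OF C2_partial_has_derivative]])
        (simp add: partial_p_def[of _ "partial_p k f"])
    ultimately show ?thesis
      unfolding X by (simp add: vf_apply_def vfX_frame p_def frechet_derivative_at[symmetric])
  qed
  then have "(\<Sum>j\<in>UNIV. vf_apply (vfX j) (vf_apply (vfX j) f) z)
      = (\<Sum>j\<in>UNIV. \<Sum>k\<in>UNIV. \<Sum>i\<in>UNIV. frame j p $ i * frame j p $ k * hess z i k)
        + (\<Sum>k\<in>UNIV. (\<Sum>j\<in>UNIV. dframe j k p (frame j p)) * partial_p k f z)"
    by (simp add: sum.distrib sum_distrib_left sum_distrib_right mult_ac) (rule sum.swap)
  also have "(\<Sum>j\<in>UNIV. \<Sum>k\<in>UNIV. \<Sum>i\<in>UNIV. frame j p $ i * frame j p $ k * hess z i k)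
      = (\<Sum>i\<in>UNIV. \<Sum>k\<in>UNIV. (\<Sum>j\<in>UNIV. frame j p $ i * frame j p $ k) * hess z i k)"
    \<comment> \<open>Reverses the order of the three sums, so that \<open>j\<close> becomes
      innermost as in \<open>frame_square\<close>.\<close>
    unfolding sum_distrib_right by (subst sum.swap, subst (2) sum.swap, subst sum.swap) (rule refl)
  finally show ?thesis
    by (simp add: frame_square sum_dframe_frame sum_distrib_left sum_divide_distrib mult_ac)
qed

lemma FP_op_sum_of_squares:
  "FP_op f z = (\<Sum>j\<in>UNIV. vf_apply (vfX j) (vf_apply (vfX j) f) z) + vf_apply (vfX_last drift) f z"
proof -
  define p S where "p = fst z" and "S = (\<Sum>k\<in>UNIV. p $ k * partial_p k f z)"
  have "vf_apply (vfX_last drift) f z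
      = (real CARD('d) - 1) * p0 p / (1 + p0 p) * S - p \<bullet> grad_y f z - p0 p * partial_t f z"
    unfolding vf_apply_def vfX_last_drift
    by (subst linear_phase_expand[OF C2_linear])
      (simp add: S_def p_def partial_p_def grad_y_def partial_y_def partial_t_def inner_vec_def
        sum_negf sum_distrib_left mult.assoc)
  \<comment> \<open>The balance d (1 + p0) = (d + p0) + (d - 1) p0 of first-order terms; it is the
    source of the factor d - 1 in \<open>drift\<close>.\<close>
  moreover have "real CARD('d) * S
      = (real CARD('d) + p0 p) / (1 + p0 p) * S + (real CARD('d) - 1) * p0 p / (1 + p0 p) * S"
    by (simp add: divide_simps) (simp add: algebra_simps)
  ultimately show ?thesis
    unfolding FP_op_expand vfX_square_expand p_def[symmetric] S_def[symmetric] by simp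
qed

end

section \<open>The rank condition\<close>

text \<open>What counts is that the y and t components vanish. \<open>L\<close> stays unspecified
  because the p-component of a commutator is later removed by the X_j.\<close>

lemma vfX_has_derivative:
  obtains L where "(vfX j has_derivative (\<lambda>v. (L v, 0, 0))) (at z)"
proof -
  have "\<exists>L. ((\<lambda>p. axis j 1 + (p $ j / (1 + p0 p)) *\<^sub>R p) has_derivative L) (at (fst z))"
    by (rule exI) (rule has_derivative_add has_derivative_scaleR has_derivative_divide'
        has_derivative_const has_derivative_ident p0_has_derivative nth_has_derivative p0_neq_0)+
  then obtain L where "(frame j has_derivative L) (at (fst z))"
    by (auto simp: frame_def[abs_def])
  then have "((\<lambda>w. (frame j (fst w), 0, 0)) has_derivative (\<lambda>v. (L (fst v), 0, 0))) (at z)"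
    by (intro has_derivative_Pair fst_comp_has_derivative has_derivative_const)
  then show ?thesis
    by (intro that[of "\<lambda>v. L (fst v)"]) (simp add: vfX_frame[abs_def])
qed

lemma vfX_last_has_derivative:
  fixes z :: "'d::finite phase"
  obtains L where
    "(vfX_last drift has_derivative (\<lambda>v. (L v, - fst v, - (fst z \<bullet> fst v / p0 (fst z))))) (at z)"
proof -
  have "\<exists>L. ((\<lambda>p :: real ^ 'd. ((real CARD('d) - 1) * p0 p / (1 + p0 p)) *\<^sub>R p)
      has_derivative L) (at (fst z))"
    by (rule exI) (rule has_derivative_add has_derivative_scaleR has_derivative_divide' has_derivative_mult
        has_derivative_const has_derivative_ident p0_has_derivative p0_neq_0)+
  then obtain L where L: "((\<lambda>p :: real ^ 'd. ((real CARD('d) - 1) * p0 p / (1 + p0 p)) *\<^sub>R p)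
      has_derivative L) (at (fst z))"
    by blast
  have "(vfX_last drift has_derivative
      (\<lambda>v. (L (fst v), - fst v, - (fst z \<bullet> fst v / p0 (fst z))))) (at z)"
    unfolding vfX_last_drift[abs_def]
    by (intro has_derivative_Pair has_derivative_minus fst_comp_has_derivative[OF L]
        fst_comp_has_derivative[OF p0_has_derivative] bounded_linear_imp_has_derivative
        bounded_linear_fst)
  then show ?thesis
    by (rule that)
qed

text \<open>The y and t components come only from differentiating X_(d+1) along X_j, since those of
  X_j are constantly zero; the last one is -(p . A e_j)/p0 = -p_j by
  \<open>inner_frame\<close>.\<close>

lemma commutator_vfX_vfX_last:
  obtains v where "commutator (vfX j) (vfX_last drift) z = (v, - frame j (fst z), - (fst z $ j))"
proof -
  obtain K where K: "(vfX j has_derivative (\<lambda>v. (K v, 0, 0))) (at z)"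
    by (rule vfX_has_derivative)
  obtain L where
    L: "(vfX_last drift has_derivative (\<lambda>v. (L v, - fst v, - (fst z \<bullet> fst v / p0 (fst z))))) (at z)"
    by (rule vfX_last_has_derivative)
  have "commutator (vfX j) (vfX_last drift) z
      = (L (vfX j z) - K (vfX_last drift z), - frame j (fst z), - (fst z $ j))"
    unfolding commutator_def frechet_derivative_at[OF K, symmetric] frechet_derivative_at[OF L, symmetric]
    by (simp add: vfX_frame inner_frame)
  then show ?thesis
    by (rule that)
qed

lemma iterated_commutators_subset_Lie: "iterated_commutators S \<subseteq> Lie S"
proof
  fix V assume "V \<in> iterated_commutators S"
  then show "V \<in> Lie S"
    unfolding Lie_def by (intro CollectI exI[of _ "{V}"] exI[of _ "\<lambda>_. 1"]) auto
qed

text \<open>The commutators \<open>[X\<^sub>j, X\<^sub>d\<^sub>+\<^sub>1]\<close> yield the directions \<open>(0, A e\<^sub>j, p\<^sub>j)\<close>, where \<open>A\<close> is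
  the frame matrix. The combination of these with \<open>y\<close>-component \<open>p\<close> has \<open>t\<close>-component
  \<open>|p|\<^sup>2 / p0\<close>, while that of \<open>Y\<close> is \<open>p0\<close>; the difference \<open>1 / p0\<close> supplies the missing
  direction.\<close>

lemma rank_at_Lie:
  "rank_at (Lie (insert (vfX_last drift) (range vfX))) z = 2 * CARD('d) + 1"
  for z :: "'d::finite phase"
proof -
  define p where "p = fst z"
  define S :: "('d phase \<Rightarrow> 'd phase) set" where "S = insert (vfX_last drift) (range vfX)"
  \<comment> \<open>Taking the span keeps the dimension, so the goal becomes
    \<open>T = UNIV\<close>.\<close>
  define T where "T = span ((\<lambda>V. V z) ` Lie S)"
  have T_add: "u + v \<in> T" and T_diff: "u - v \<in> T" and T_scale: "a *\<^sub>R u \<in> T"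
    if "u \<in> T" "v \<in> T" for u v a
    using that by (auto simp: T_def intro: span_add span_diff span_scale)
  have T_sum: "(\<Sum>j\<in>UNIV. a j *\<^sub>R u j) \<in> T" if "\<And>j. u j \<in> T" for a :: "'d \<Rightarrow> real" and u
    using that unfolding T_def by (intro span_sum span_scale)
  have in_T: "V z \<in> T" if "V \<in> iterated_commutators S" for V
    using that iterated_commutators_subset_Lie unfolding T_def by (blast intro: span_base)
  have frame_in: "(frame j p, 0, 0) \<in> T" for j
    using in_T[of "vfX j"] by (auto simp: S_def vfX_frame p_def intro: iterated_commutators.base)
  \<comment> \<open>From here on any p-component of a vector in \<open>T\<close> can be subtracted,
    including the unspecified one of the commutators.\<close>
  have p_dir: "(v, 0, 0) \<in> T" for v
  proof -
    obtain a where v: "v = (\<Sum>j\<in>UNIV. a j *\<^sub>R frame j p)"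
      by (rule that) (rule frame_spans)
    have "(\<Sum>j\<in>UNIV. a j *\<^sub>R (frame j p, 0 :: real ^ 'd, 0 :: real)) = (v, 0, 0)"
      by (simp add: v prod_eq_iff fst_sum snd_sum)
    with T_sum[of "\<lambda>j. (frame j p, 0, 0)" a, OF frame_in] show ?thesis by (simp only:)
  qed
  have comm_in: "(0, frame j p, p $ j) \<in> T" for j
  proof -
    obtain v where v: "commutator (vfX j) (vfX_last drift) z = (v, - frame j p, - (p $ j))"
      unfolding p_def by (rule commutator_vfX_vfX_last)
    have "commutator (vfX j) (vfX_last drift) \<in> iterated_commutators S"
      by (intro iterated_commutators.step iterated_commutators.base) (auto simp: S_def)
    from T_diff[OF p_dir[of v] in_T[OF this]] show ?thesis
      by (simp add: v)
  qed
  have Y_in: "(0, p, p0 p) \<in> T"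
  proof -
    have "vfX_last drift z \<in> T"
      by (intro in_T iterated_commutators.base) (simp add: S_def)
    from T_diff[OF p_dir[of "fst (vfX_last drift z)"] this] show ?thesis
      by (simp add: vfX_last_drift p_def)
  qed
  have t_dir: "(0, 0, s) \<in> T" for s
  proof -
    \<comment> \<open>The coefficients p_j/p0 are those of A^(-1) p, as A p = p0 p.\<close>
    have "(\<Sum>j\<in>UNIV. (p $ j / p0 p) *\<^sub>R frame j p) = p"
      by (simp add: vec_eq_iff sum_frame_nth sum_divide_distrib[symmetric])
    moreover have "(\<Sum>j\<in>UNIV. p $ j / p0 p * p $ j) = p0 p - 1 / p0 p"
      by (simp add: sum_divide_distrib[symmetric] sum_squares_p0 field_simps power2_eq_square)
    ultimately have "(\<Sum>j\<in>UNIV. (p $ j / p0 p) *\<^sub>R (0 :: real ^ 'd, frame j p, p $ j)) = (0, p, p0 p - 1 / p0 p)"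
      by (simp add: prod_eq_iff fst_sum snd_sum)
    with T_sum[of "\<lambda>j. (0, frame j p, p $ j)" "\<lambda>j. p $ j / p0 p", OF comm_in]
    have "(0, p, p0 p - 1 / p0 p) \<in> T"
      by (simp only:)
    from T_diff[OF Y_in this] have "(0, 0, 1 / p0 p) \<in> T"
      by simp
    from T_scale[OF this this, of "s * p0 p"] show ?thesis
      by simp
  qed
  have y_dir: "(0, w, 0) \<in> T" for w
  proof -
    obtain a where w: "w = (\<Sum>j\<in>UNIV. a j *\<^sub>R frame j p)"
      by (rule that) (rule frame_spans)
    \<comment> \<open>The t-direction, now available, strips p_j from the commutator
      vectors.\<close>
    have "(0, frame j p, 0) \<in> T" for j
      using T_diff[OF comm_in t_dir[of "p $ j"], of j] by simp
    moreover have "(\<Sum>j\<in>UNIV. a j *\<^sub>R (0 :: real ^ 'd, frame j p, 0 :: real)) = (0, w, 0)"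
      by (simp add: w prod_eq_iff fst_sum snd_sum)
    ultimately show ?thesis
      using T_sum[of "\<lambda>j. (0, frame j p, 0)" a] by (simp only:)
  qed
  have "(v, w, s) \<in> T" for v w s
    using T_add[OF p_dir[of v] T_add[OF y_dir[of w] t_dir[of s]]] by simp
  then have "T = UNIV"
    by auto
  then have "dim ((\<lambda>V. V z) ` Lie S) = DIM('d phase)"
    unfolding T_def by (subst dim_span[symmetric]) simp
  then show ?thesis
    by (simp add: rank_at_def S_def)
qed

theorem mainTheorem3:
  shows "\<exists>c :: 'd::finite \<Rightarrow> real ^ 'd \<Rightarrow> real.
    (\<forall>k. is_smooth (c k)) \<and>
    (\<forall>f :: 'd phase \<Rightarrow> real. is_Ck 2 f \<longrightarrow>
       (\<forall>z. FP_op f z =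
          (\<Sum>j\<in>UNIV. vf_apply (vfX j) (vf_apply (vfX j) f) z) + vf_apply (vfX_last c) f z)) \<and>
    (\<forall>z :: 'd phase. rank_at (Lie (insert (vfX_last c) (range vfX))) z = 2 * CARD('d) + 1)"
  by (intro exI[of _ drift] conjI allI impI is_smooth_drift FP_op_sum_of_squares rank_at_Lie)

end
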